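(* For every integer $r\ge 3$, the $r$-dimensional butterfly network satisfies $\beta'(BF(r))=2^{r+1}$.
   Context: The butterfly network $BF(r)$ has vertex set $\{[s,j]: s\in\{0,1\}^r,\ j\in\{0,1,\dots,r\}\}$ (so $2^r(r+1)$ vertices); writing $s=s_1\dots s_r$, for each $j\in\{1,\dots,r\}$ the vertices $[s,j-1]$ and $[s',j]$ are adjacent if and only if either $s=s'$ or $s$ and $s'$ differ exactly in the $j$-th bit; there are no other edges. For a connected graph $G$, a set $S\subseteq V(G)$ is a resolving set if for every pair of distinct vertices $a,b$ there is $u\in S$ with $d(a,u)\neq d(b,u)$ ($d$ the shortest-path distance); $S$ is a fault-tolerant resolving set if $S\setminus\{x\}$ is a resolving set for every $x\in S$; $\beta'(G)$ is the minimum cardinality of a fault-tolerant resolving set of $G$. *)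

theory Defs
  imports "HOL-Library.Extended_Nat"
begin

text \<open>A simple graph is given by its vertex set \<open>V\<close> and a symmetric irreflexive adjacency
  relation \<open>E \<subseteq> V \<times> V\<close>; \<open>(a, b) \<in> E ^^ n\<close> says that there is a walk of length \<open>n\<close> from
  \<open>a\<close> to \<open>b\<close>.\<close>

text \<open>The value is \<open>\<infinity>\<close> if \<open>b\<close> is not reachable from \<open>a\<close>; in a connected graph this does not occur.\<close>

definition graph_dist :: "'v rel \<Rightarrow> 'v \<Rightarrow> 'v \<Rightarrow> enat" where
  "graph_dist E a b = (INF n\<in>{n. (a, b) \<in> E ^^ n}. enat n)"

definition resolving_set :: "'v set \<Rightarrow> 'v rel \<Rightarrow> 'v set \<Rightarrow> bool" where
  "resolving_set V E S \<longleftrightarrow> S \<subseteq> V \<and>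
     (\<forall>a\<in>V. \<forall>b\<in>V. a \<noteq> b \<longrightarrow> (\<exists>u\<in>S. graph_dist E a u \<noteq> graph_dist E b u))"

text \<open>For nonempty \<open>S \<subseteq> V\<close> the first conjunct follows from the second. It only excludes the empty
  set (in graphs with at least two vertices), which would satisfy the second conjunct vacuously.\<close>

definition fault_tolerant_resolving_set :: "'v set \<Rightarrow> 'v rel \<Rightarrow> 'v set \<Rightarrow> bool" where
  "fault_tolerant_resolving_set V E S \<longleftrightarrow>
     resolving_set V E S \<and> (\<forall>x\<in>S. resolving_set V E (S - {x}))"

text \<open>Intended for finite graphs. There the set of cardinalities is nonempty, since \<open>V\<close> itself is
  a fault-tolerant resolving set.\<close>

definition fault_tolerant_metric_dim :: "'v set \<Rightarrow> 'v rel \<Rightarrow> nat" where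
  "fault_tolerant_metric_dim V E =
     (LEAST k. \<exists>S. fault_tolerant_resolving_set V E S \<and> card S = k)"

text \<open>The vertex \<open>[s, j]\<close> is the pair \<open>(s, j)\<close>, where the bit string \<open>s\<close> is a list of length \<open>r\<close>.
  Lists are indexed from \<open>0\<close>, so the \<open>i\<close>-th bit of \<open>s\<close> is \<open>s ! (i - 1)\<close>.\<close>

definition butterfly_verts :: "nat \<Rightarrow> (bool list \<times> nat) set" where
  "butterfly_verts r = {(s, j). length s = r \<and> j \<le> r}"

definition butterfly_up :: "nat \<Rightarrow> (bool list \<times> nat) rel" where
  "butterfly_up r = {((s, j - 1), (s', j)) | s s' j.
     length s = r \<and> length s' = r \<and> j \<in> {1..r} \<and>
     (s = s' \<or> {i \<in> {1..r}. s ! (i - 1) \<noteq> s' ! (i - 1)} = {j})}"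

definition butterfly_edges :: "nat \<Rightarrow> (bool list \<times> nat) rel" where
  "butterfly_edges r = butterfly_up r \<union> (butterfly_up r)\<inverse>"

lemma butterfly_edges_subset: "butterfly_edges r \<subseteq> butterfly_verts r \<times> butterfly_verts r"
  unfolding butterfly_edges_def butterfly_up_def butterfly_verts_def by force

lemma butterfly_edges_sym: "sym (butterfly_edges r)"
  unfolding butterfly_edges_def by (rule sym_Un_converse)

lemma butterfly_edges_irrefl: "irrefl (butterfly_edges r)"
proof -
  have "snd q = Suc (snd p)" if "(p, q) \<in> butterfly_up r" for p q
    using that unfolding butterfly_up_def by fastforce
  then show ?thesis
    unfolding butterfly_edges_def irrefl_def by fastforce
qed

end

theory Submission
  imports Defs
begin

text \<open>Two vertices of level \<open>0\<close> that differ only in the first bit have the same neighbours, and so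
  do two vertices of level \<open>r\<close> that differ only in the last bit. Nothing but the two twins
  themselves resolves such a pair, so a fault-tolerant resolving set contains all \<open>2 \<cdot> 2 ^ r\<close>
  vertices of these two levels. Conversely, a walk from level \<open>j\<close> straight down to level \<open>0\<close> can
  change only the first \<open>j\<close> bits, and a walk straight up to level \<open>r\<close> only the other ones; hence each
  pair of vertices is resolved by two different vertices of the two extreme levels.\<close>

section \<open>Distances and fault tolerance\<close>

lemma graph_dist_le:
  assumes "(a, u) \<in> E ^^ n"
  shows "graph_dist E a u \<le> enat n"
  using assms unfolding graph_dist_def by (auto intro: INF_lower2)

lemma walk_of_graph_dist_le:
  assumes "graph_dist E a u \<le> enat n"
  obtains m where "m \<le> n" "(a, u) \<in> E ^^ m"
proof -
  \<comment> \<open>The strict bound lets \<open>INF_less_iff\<close> extract an actual walk from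
    the infimum.\<close>
  have "graph_dist E a u < enat (Suc n)"
    using assms by (rule le_less_trans) simp
  then show ?thesis
    using that unfolding graph_dist_def INF_less_iff by (auto simp: less_Suc_eq_le)
qed

lemma graph_dist_neqI:
  assumes "(a, u) \<in> E ^^ n" "\<And>m. m \<le> n \<Longrightarrow> (b, u) \<notin> E ^^ m"
  shows "graph_dist E a u \<noteq> graph_dist E b u"
  using assms graph_dist_le walk_of_graph_dist_le by metis

text \<open>A walk of positive length from \<open>a\<close> becomes one from \<open>b\<close> by
  exchanging its starting point; the empty walk does not end in \<open>u\<close>.\<close>

lemma graph_dist_twin:
  assumes "E `` {a} = E `` {b}" "u \<noteq> a" "u \<noteq> b"
  shows "graph_dist E a u = graph_dist E b u"
proof -
  have "(a, u) \<in> E ^^ n \<longleftrightarrow> (b, u) \<in> E ^^ n" for n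
  proof (cases n)
    case 0
    then show ?thesis using assms by auto
  next
    case (Suc m)
    have "(a, z) \<in> E \<longleftrightarrow> (b, z) \<in> E" for z
      using assms(1) by auto
    then show ?thesis
      unfolding Suc by (metis relpow_Suc_D2 relpow_Suc_I2)
  qed
  then show ?thesis by (simp add: graph_dist_def)
qed

lemma twin_in_fault_tolerant_resolving_set:
  assumes S: "fault_tolerant_resolving_set V E S"
    and ab: "a \<in> V" "b \<in> V" "a \<noteq> b" "E `` {a} = E `` {b}"
  shows "a \<in> S"
proof (rule ccontr)
  assume "a \<notin> S"
  have "resolving_set V E (S - {b})"
    using S unfolding fault_tolerant_resolving_set_def by (cases "b \<in> S") auto
  then obtain u where "u \<in> S - {b}" "graph_dist E a u \<noteq> graph_dist E b u"
    using ab unfolding resolving_set_def by blast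
  then show False
    using graph_dist_twin[OF ab(4), of u] \<open>a \<notin> S\<close> by auto
qed

text \<open>Deleting a single vertex leaves at least one of \<open>u\<close> and \<open>v\<close> in
  place.\<close>

lemma fault_tolerant_resolving_setI:
  assumes "S \<subseteq> V"
    and "\<And>a b. \<lbrakk>a \<in> V; b \<in> V; a \<noteq> b\<rbrakk> \<Longrightarrow> \<exists>u\<in>S. \<exists>v\<in>S. u \<noteq> v \<and>
      graph_dist E a u \<noteq> graph_dist E b u \<and> graph_dist E a v \<noteq> graph_dist E b v"
  shows "fault_tolerant_resolving_set V E S"
proof -
  \<comment> \<open>\<open>X\<close> is \<open>{}\<close> or \<open>{x}\<close>, so one argument
    covers both conjuncts of fault tolerance.\<close>
  have "resolving_set V E (S - X)" if "X \<subseteq> {x}" for X x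
    unfolding resolving_set_def
  proof (intro conjI ballI impI)
    fix a b assume "a \<in> V" "b \<in> V" "a \<noteq> b"
    then obtain u v where "u \<in> S" "v \<in> S" "u \<noteq> v"
      "graph_dist E a u \<noteq> graph_dist E b u" "graph_dist E a v \<noteq> graph_dist E b v"
      using assms(2) by metis
    moreover have "u \<notin> X \<or> v \<notin> X"
      using that \<open>u \<noteq> v\<close> by auto
    ultimately show "\<exists>u\<in>S - X. graph_dist E a u \<noteq> graph_dist E b u"
      by blast
  qed (use assms(1) in auto)
  from this[of "{}"] this[of "{x}" x for x] show ?thesis
    unfolding fault_tolerant_resolving_set_def by auto
qed

section \<open>Walks in the butterfly network\<close>

text \<open>With list indices counted from 0, an edge between levels \<open>j\<close> and
  \<open>Suc j\<close> may flip index \<open>j\<close>; both kinds of edges then amount to agreement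
  at all other indices.\<close>

lemma butterfly_up_iff:
  "((s, j), (s', j')) \<in> butterfly_up r \<longleftrightarrow> length s = r \<and> length s' = r \<and> j < r \<and> j' = Suc j \<and>
     (\<forall>i<r. i \<noteq> j \<longrightarrow> s ! i = s' ! i)"
proof -
  have "(s = s' \<or> {i \<in> {1..r}. s ! (i - 1) \<noteq> s' ! (i - 1)} = {Suc j}) \<longleftrightarrow>
      (\<forall>i<r. i \<noteq> j \<longrightarrow> s ! i = s' ! i)" (is "?L \<longleftrightarrow> ?R")
    if "length s = r" "length s' = r" "j < r"
  proof
    assume L: ?L
    show ?R
    proof (intro allI impI)
      fix i assume "i < r" "i \<noteq> j"
      from L show "s ! i = s' ! i"
      proof
        assume D: "{i \<in> {1..r}. s ! (i - 1) \<noteq> s' ! (i - 1)} = {Suc j}"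
        \<comment> \<open>\<open>Suc i\<close> is the one-based position of list index
          \<open>i\<close>.\<close>
        have "Suc i \<notin> {Suc j}" using \<open>i \<noteq> j\<close> by simp
        then show ?thesis using \<open>i < r\<close> unfolding D[symmetric] by simp
      qed simp
    qed
  next
    assume R: ?R
    show ?L
    proof (cases "s ! j = s' ! j")
      case True
      then have "s = s'" using R that by (auto simp: list_eq_iff_nth_eq)
      then show ?thesis ..
    next
      case False
      have "i \<in> {1..r} \<and> s ! (i - 1) \<noteq> s' ! (i - 1) \<longleftrightarrow> i = Suc j" for i
        using R False \<open>j < r\<close> by (cases i) (auto simp: Suc_le_eq)
      then show ?thesis by blast
    qed
  qed
  moreover have "((s, j), (s', j')) \<in> butterfly_up r \<longleftrightarrow> length s = r \<and> length s' = r \<and> j < r \<and>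
      j' = Suc j \<and> (s = s' \<or> {i \<in> {1..r}. s ! (i - 1) \<noteq> s' ! (i - 1)} = {Suc j})"
    unfolding butterfly_up_def mem_Collect_eq prod.inject
    by (cases j') (simp_all add: Suc_le_eq, metis)
  ultimately show ?thesis by blast
qed

text \<open>Each step changes the level by one, so \<open>j = k + n\<close> forces every step to
  descend. Such a walk stays below level \<open>j\<close> after its start and can flip only indices
  less than \<open>j\<close>.\<close>

lemma walk_down:
  assumes "((s, j), (t, k)) \<in> butterfly_edges r ^^ n"
  shows "j \<le> k + n \<and> (j = k + n \<longrightarrow> (\<forall>i. j \<le> i \<and> i < r \<longrightarrow> s ! i = t ! i))"
  using assms
proof (induction n arbitrary: s j)
  case 0
  then show ?case by simp
next
  case (Suc n)
  from Suc.prems obtain s' j' where e: "((s, j), (s', j')) \<in> butterfly_edges r"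
    and w: "((s', j'), (t, k)) \<in> butterfly_edges r ^^ n"
    by (metis relpow_Suc_D2 surj_pair)
  from e show ?case
    using Suc.IH[OF w] by (auto simp: butterfly_edges_def butterfly_up_iff)
qed

text \<open>Mirror image: a walk that rises at every step from level \<open>j\<close> can flip only
  indices from \<open>j\<close> on.\<close>

lemma walk_up:
  assumes "((s, j), (t, k)) \<in> butterfly_edges r ^^ n"
  shows "k \<le> j + n \<and> (k = j + n \<longrightarrow> (\<forall>i. i < j \<and> i < r \<longrightarrow> s ! i = t ! i))"
  using assms
proof (induction n arbitrary: s j)
  case 0
  then show ?case by simp
next
  case (Suc n)
  from Suc.prems obtain s' j' where e: "((s, j), (s', j')) \<in> butterfly_edges r"
    and w: "((s', j'), (t, k)) \<in> butterfly_edges r ^^ n"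
    by (metis relpow_Suc_D2 surj_pair)
  from e show ?case
    using Suc.IH[OF w] by (auto simp: butterfly_edges_def butterfly_up_iff)
qed

lemma straight_walk_down:
  assumes "length s = r" "j \<le> r"
  shows "((s, j), (s, 0)) \<in> butterfly_edges r ^^ j"
  using assms(2)
proof (induction j)
  case (Suc j)
  have "((s, Suc j), (s, j)) \<in> butterfly_edges r"
    using Suc.prems assms(1) by (simp add: butterfly_edges_def butterfly_up_iff)
  then show ?case
    using Suc by (meson Suc_leD relpow_Suc_I2)
qed simp

lemma straight_walk_up:
  assumes "length s = r" "j \<le> r"
  shows "((s, j), (s, r)) \<in> butterfly_edges r ^^ (r - j)"
  using assms(2)
proof (induction rule: inc_induct)
  case (step j)
  have "((s, j), (s, Suc j)) \<in> butterfly_edges r"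
    using step.hyps assms(1) by (simp add: butterfly_edges_def butterfly_up_iff)
  then have "((s, j), (s, r)) \<in> butterfly_edges r ^^ Suc (r - Suc j)"
    using step.IH by (rule relpow_Suc_I2)
  then show ?case
    using step.hyps by (simp add: Suc_diff_Suc)
qed simp

section \<open>The extreme levels\<close>

text \<open>The straight walk bounds the first distance by \<open>j\<close>. From
  \<open>(s', j')\<close> a walk this short cannot reach level 0 if \<open>j < j'\<close>; if
  \<open>j = j'\<close>, it would descend throughout and preserve index \<open>i\<close>.\<close>

lemma resolved_by_bottom:
  assumes "length s = r" "j \<le> r"
    and "j < j' \<or> j = j' \<and> (\<exists>i. j \<le> i \<and> i < r \<and> s' ! i \<noteq> s ! i)"
  shows "graph_dist (butterfly_edges r) (s, j) (s, 0) \<noteq>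
    graph_dist (butterfly_edges r) (s', j') (s, 0)"
proof (rule graph_dist_neqI)
  show "((s, j), (s, 0)) \<in> butterfly_edges r ^^ j"
    by (rule straight_walk_down) fact+
  show "((s', j'), (s, 0)) \<notin> butterfly_edges r ^^ m" if "m \<le> j" for m
    using walk_down[of s' j' s 0 m r] that assms(3) by auto
qed

lemma resolved_by_top:
  assumes "length s = r" "j \<le> r"
    and "j' < j \<or> j' = j \<and> (\<exists>i. i < j \<and> i < r \<and> s' ! i \<noteq> s ! i)"
  shows "graph_dist (butterfly_edges r) (s, j) (s, r) \<noteq>
    graph_dist (butterfly_edges r) (s', j') (s, r)"
proof (rule graph_dist_neqI)
  show "((s, j), (s, r)) \<in> butterfly_edges r ^^ (r - j)"
    by (rule straight_walk_up) fact+
  show "((s', j'), (s, r)) \<notin> butterfly_edges r ^^ m" if "m \<le> r - j" for m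
    using walk_up[of s' j' s r m r] that assms(2,3) by auto
qed

definition extreme_levels :: "nat \<Rightarrow> (bool list \<times> nat) set" where
  "extreme_levels r = {s. length s = r} \<times> {0, r}"

lemma card_extreme_levels:
  assumes "r > 0"
  shows "card (extreme_levels r) = 2 ^ (r + 1)"
proof -
  have "card {s :: bool list. length s = r} = 2 ^ r"
    using card_lists_length_eq[of "UNIV :: bool set" r] by simp
  \<comment> \<open>\<open>r > 0\<close> makes \<open>{0, r}\<close> a two-element set, which
    doubles \<open>2 ^ r\<close>.\<close>
  then show ?thesis
    using assms by (simp add: extreme_levels_def card_cartesian_product)
qed

lemma fault_tolerant_resolving_set_extreme_levels:
  assumes "r > 0"
  shows "fault_tolerant_resolving_set (butterfly_verts r) (butterfly_edges r) (extreme_levels r)"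
proof (rule fault_tolerant_resolving_setI)
  show "extreme_levels r \<subseteq> butterfly_verts r"
    by (auto simp: extreme_levels_def butterfly_verts_def)
next
  let ?d = "graph_dist (butterfly_edges r)"
  \<comment> \<open>The witnesses are the bottom of the lower vertex's column and the top of the
    higher one's; they differ even if \<open>s = s'\<close>, because \<open>r > 0\<close>.\<close>
  have lt: "\<exists>u\<in>extreme_levels r. \<exists>v\<in>extreme_levels r. u \<noteq> v \<and>
      ?d (s, j) u \<noteq> ?d (s', j') u \<and> ?d (s, j) v \<noteq> ?d (s', j') v"
    if "length s = r" "length s' = r" "j < j'" "j' \<le> r" for s s' j j'
  proof (intro bexI conjI)
    show "(s, 0) \<noteq> (s', r)" using assms by simp
    show "?d (s, j) (s, 0) \<noteq> ?d (s', j') (s, 0)"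
      using that by (intro resolved_by_bottom) auto
    show "?d (s, j) (s', r) \<noteq> ?d (s', j') (s', r)"
      using that by (intro resolved_by_top[symmetric]) auto
  qed (use that in \<open>auto simp: extreme_levels_def\<close>)
  fix a b assume ab: "a \<in> butterfly_verts r" "b \<in> butterfly_verts r" "a \<noteq> b"
  obtain s j s' j' where eq: "a = (s, j)" "b = (s', j')" by fastforce
  have len: "length s = r" "length s' = r" and le: "j \<le> r" "j' \<le> r"
    using ab eq by (auto simp: butterfly_verts_def)
  consider "j < j'" | "j' < j" | "j = j'" by linarith
  then show "\<exists>u\<in>extreme_levels r. \<exists>v\<in>extreme_levels r. u \<noteq> v \<and>
      ?d a u \<noteq> ?d b u \<and> ?d a v \<noteq> ?d b v"
  proof cases
    case 1
    then show ?thesis using lt[of s s' j j'] len le eq by simp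
  next
    case 2
    then show ?thesis using lt[of s' s j' j] len le eq by metis
  next
    case 3
    have "s \<noteq> s'" using ab eq 3 by simp
    then obtain i where i: "i < r" "s ! i \<noteq> s' ! i"
      using len by (auto simp: list_eq_iff_nth_eq)
    \<comment> \<open>The position of a differing index \<open>i\<close> relative to
      \<open>j\<close> decides between bottom and top. The same \<open>k\<close> works for both
      columns, which gives two distinct resolvers.\<close>
    have "\<exists>k\<in>{0, r}. ?d (s, j) (s, k) \<noteq> ?d (s', j) (s, k) \<and>
        ?d (s', j) (s', k) \<noteq> ?d (s, j) (s', k)"
    proof (cases "j \<le> i")
      case True
      have "?d (s, j) (s, 0) \<noteq> ?d (s', j) (s, 0)" "?d (s', j) (s', 0) \<noteq> ?d (s, j) (s', 0)"
        by (intro resolved_by_bottom disjI2 conjI refl exI[of _ i] len le 3 True i i(2)[symmetric])+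
      then show ?thesis by blast
    next
      case False
      then have "i < j" by simp
      have "?d (s, j) (s, r) \<noteq> ?d (s', j) (s, r)" "?d (s', j) (s', r) \<noteq> ?d (s, j) (s', r)"
        by (intro resolved_by_top disjI2 conjI refl exI[of _ i] len le 3 \<open>i < j\<close> i i(2)[symmetric])+
      then show ?thesis by blast
    qed
    then obtain k where "k \<in> {0, r}" "?d a (s, k) \<noteq> ?d b (s, k)" "?d a (s', k) \<noteq> ?d b (s', k)"
      unfolding eq 3[symmetric] by metis
    moreover from this have "(s, k) \<in> extreme_levels r" "(s', k) \<in> extreme_levels r"
      using len by (auto simp: extreme_levels_def)
    ultimately show ?thesis using \<open>s \<noteq> s'\<close> by blast
  qed
qed

text \<open>Edges at level 0 can flip only index 0, and those at level \<open>r\<close> only index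
  \<open>r - 1\<close>, so toggling that bit leaves the neighbours unchanged.\<close>

lemma butterfly_twins:
  assumes "r > 0" "length s = r" "j = 0 \<and> l = 0 \<or> j = r \<and> l = r - 1"
  shows "butterfly_edges r `` {(s, j)} = butterfly_edges r `` {(s[l := \<not> s ! l], j)}"
proof -
  let ?t = "s[l := \<not> s ! l]"
  have t: "length ?t = r" "\<And>i. i \<noteq> l \<Longrightarrow> ?t ! i = s ! i"
    using assms(2) by simp_all
  have "((s, j), (u, k)) \<in> butterfly_edges r \<longleftrightarrow> ((?t, j), (u, k)) \<in> butterfly_edges r" for u k
    using assms(3)
  proof
    assume "j = 0 \<and> l = 0"
    then show ?thesis
      using assms(2) t by (simp add: butterfly_edges_def butterfly_up_iff)
  next
    assume "j = r \<and> l = r - 1"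
    \<comment> \<open>Neighbours of level \<open>r\<close> lie on the level \<open>k\<close> with
      \<open>r = Suc k\<close>, and their edges may flip index \<open>k\<close>, which is
      \<open>l\<close>.\<close>
    moreover from this have "r = Suc k \<Longrightarrow> l = k" by simp
    ultimately show ?thesis
      using assms(2) t by (auto simp: butterfly_edges_def butterfly_up_iff)
  qed
  then show ?thesis by auto
qed

lemma extreme_levels_subset_fault_tolerant_resolving_set:
  assumes "r > 0" "fault_tolerant_resolving_set (butterfly_verts r) (butterfly_edges r) S"
  shows "extreme_levels r \<subseteq> S"
proof
  fix x assume "x \<in> extreme_levels r"
  then obtain s j where x: "x = (s, j)" "length s = r" "j = 0 \<or> j = r"
    by (auto simp: extreme_levels_def)
  define l where "l = (if j = 0 then 0 else r - 1)"
  have l: "l < r" "j = 0 \<and> l = 0 \<or> j = r \<and> l = r - 1"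
    using x assms(1) by (auto simp: l_def)
  \<comment> \<open>Here \<open>l < r\<close> matters: an update outside the list would change
    nothing.\<close>
  have "s \<noteq> s[l := \<not> s ! l]"
    using l(1) x(2) by (metis nth_list_update_eq)
  then show "x \<in> S"
    unfolding x(1)
    using twin_in_fault_tolerant_resolving_set[OF assms(2) _ _ _ butterfly_twins[OF assms(1) x(2) l(2)]]
      x by (auto simp: butterfly_verts_def)
qed

theorem theorem3p1:
  fixes r :: nat
  assumes "r \<ge> 3"
  shows "fault_tolerant_metric_dim (butterfly_verts r) (butterfly_edges r) = 2 ^ (r + 1)"
  unfolding fault_tolerant_metric_dim_def
proof (rule Least_equality)
  have "r > 0" using assms by simp
  then show "\<exists>S. fault_tolerant_resolving_set (butterfly_verts r) (butterfly_edges r) S \<and>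
      card S = 2 ^ (r + 1)"
    using fault_tolerant_resolving_set_extreme_levels card_extreme_levels by blast
  \<comment> \<open>Finiteness passes from the vertex set to \<open>S\<close>, as
    \<open>card_mono\<close> requires.\<close>
  have "butterfly_verts r = {s. length s = r} \<times> {..r}"
    by (auto simp: butterfly_verts_def)
  then have fin: "finite (butterfly_verts r)"
    using finite_lists_length_eq[of "UNIV :: bool set" r] by simp
  fix k assume "\<exists>S. fault_tolerant_resolving_set (butterfly_verts r) (butterfly_edges r) S \<and>
      card S = k"
  then obtain S where S: "fault_tolerant_resolving_set (butterfly_verts r) (butterfly_edges r) S"
    and k: "card S = k" by blast
  have "S \<subseteq> butterfly_verts r"
    using S by (simp add: fault_tolerant_resolving_set_def resolving_set_def)
  then have "card (extreme_levels r) \<le> card S"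
    using extreme_levels_subset_fault_tolerant_resolving_set[OF \<open>r > 0\<close> S] fin
    by (metis card_mono finite_subset)
  then show "2 ^ (r + 1) \<le> k"
    using card_extreme_levels[OF \<open>r > 0\<close>] k by simp
qed

end
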